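(* Let $\mathfrak{g}$ be a compact semisimple real Lie algebra and let $A,B\in\mathfrak{g}$. Then there exists a regular element $X\in\mathfrak{g}$ such that $A,B\in[X,\mathfrak{g}]=\mathrm{ad}(X)(\mathfrak{g})$.
   Context: A real semisimple Lie algebra $\mathfrak{g}$ is called compact if its adjoint group $G=\langle \exp(\mathrm{ad}(X))\mid X\in\mathfrak{g}\rangle$ is compact; its Killing form $\langle\cdot,\cdot\rangle$ is then negative definite and $G$-invariant. A Cartan subalgebra (CSA) of $\mathfrak{g}$ is a maximal abelian subalgebra. An element $X\in\mathfrak{g}$ is regular if its centralizer $\mathrm{Cen}_{\mathfrak{g}}(X)$ is a Cartan subalgebra (equivalently, $X$ lies in a CSA $\mathfrak{h}$ and $\mathrm{Cen}_{\mathfrak{g}}(X)=\mathfrak{h}$). *)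

theory Defs
  imports "HOL-Analysis.Analysis"
begin

text \<open>A finite-dimensional real Lie algebra is modelled as a euclidean_space type
  (finite-dimensional real vector space) together with a bracket.\<close>

definition lie_algebra :: "('a::real_vector \<Rightarrow> 'a \<Rightarrow> 'a) \<Rightarrow> bool" where
  "lie_algebra br \<longleftrightarrow> bilinear br \<and> (\<forall>x. br x x = 0) \<and>
     (\<forall>x y z. br x (br y z) + br y (br z x) + br z (br x y) = 0)"

definition lie_ideal :: "('a::real_vector \<Rightarrow> 'a \<Rightarrow> 'a) \<Rightarrow> 'a set \<Rightarrow> bool" where
  "lie_ideal br I \<longleftrightarrow> subspace I \<and> (\<forall>x y. y \<in> I \<longrightarrow> br x y \<in> I)"

definition derived :: "('a::real_vector \<Rightarrow> 'a \<Rightarrow> 'a) \<Rightarrow> 'a set \<Rightarrow> 'a set" where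
  "derived br I = span {br x y | x y. x \<in> I \<and> y \<in> I}"

definition solvable :: "('a::real_vector \<Rightarrow> 'a \<Rightarrow> 'a) \<Rightarrow> 'a set \<Rightarrow> bool" where
  "solvable br I \<longleftrightarrow> (\<exists>n. (derived br ^^ n) I = {0})"

definition semisimple :: "('a::real_vector \<Rightarrow> 'a \<Rightarrow> 'a) \<Rightarrow> bool" where
  "semisimple br \<longleftrightarrow> lie_algebra br \<and>
     (\<forall>I. lie_ideal br I \<and> solvable br I \<longrightarrow> I = {0})"

definition lin_exp :: "('a::real_normed_vector \<Rightarrow> 'a) \<Rightarrow> 'a \<Rightarrow> 'a" where
  "lin_exp f v = (\<Sum>n. (f ^^ n) v /\<^sub>R fact n)"

inductive_set adjoint_group :: "('a::real_normed_vector \<Rightarrow> 'a \<Rightarrow> 'a) \<Rightarrow> ('a \<Rightarrow> 'a) set"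
  for br where
  ag_id: "id \<in> adjoint_group br"
| ag_mul: "g \<in> adjoint_group br \<Longrightarrow> lin_exp (br X) \<circ> g \<in> adjoint_group br"
| ag_inv: "g \<in> adjoint_group br \<Longrightarrow> inv (lin_exp (br X)) \<circ> g \<in> adjoint_group br"

definition compact_semisimple :: "('a::euclidean_space \<Rightarrow> 'a \<Rightarrow> 'a) \<Rightarrow> bool" where
  "compact_semisimple br \<longleftrightarrow> semisimple br \<and> compact (Blinfun ` adjoint_group br)"

definition lie_subalgebra :: "('a::real_vector \<Rightarrow> 'a \<Rightarrow> 'a) \<Rightarrow> 'a set \<Rightarrow> bool" where
  "lie_subalgebra br h \<longleftrightarrow> subspace h \<and> (\<forall>x\<in>h. \<forall>y\<in>h. br x y \<in> h)"

definition abelian_subalgebra :: "('a::real_vector \<Rightarrow> 'a \<Rightarrow> 'a) \<Rightarrow> 'a set \<Rightarrow> bool" where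
  "abelian_subalgebra br h \<longleftrightarrow> lie_subalgebra br h \<and> (\<forall>x\<in>h. \<forall>y\<in>h. br x y = 0)"

text \<open>Cartan subalgebra (in the compact setting): maximal abelian subalgebra.\<close>
definition cartan_subalgebra :: "('a::real_vector \<Rightarrow> 'a \<Rightarrow> 'a) \<Rightarrow> 'a set \<Rightarrow> bool" where
  "cartan_subalgebra br h \<longleftrightarrow> abelian_subalgebra br h \<and>
     (\<forall>k. abelian_subalgebra br k \<and> h \<subseteq> k \<longrightarrow> k = h)"

definition centralizer :: "('a::real_vector \<Rightarrow> 'a \<Rightarrow> 'a) \<Rightarrow> 'a \<Rightarrow> 'a set" where
  "centralizer br X = {Y. br X Y = 0}"

definition regular :: "('a::real_vector \<Rightarrow> 'a \<Rightarrow> 'a) \<Rightarrow> 'a \<Rightarrow> bool" where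
  "regular br X \<longleftrightarrow> cartan_subalgebra br (centralizer br X)"

end

theory Submission
  imports Defs
begin

text \<open>
  Since the one-parameter groups \<open>exp (s ad X)\<close> are bounded, each \<open>ad X\<close> is skew for some inner
  product, so the trace of \<open>(ad X)\<^sup>2\<close> is negative for \<open>X \<noteq> 0\<close>: minus the Killing form is an invariant
  inner product. For it, the range of \<open>ad X\<close> is the orthogonal complement of the centralizer of \<open>X\<close>,
  and every Cartan subalgebra is the centralizer of one of its elements. So it suffices to find a
  Cartan subalgebra \<open>h\<close> orthogonal to \<open>A\<close> and \<open>B\<close>.

  Choose \<open>h\<close>, among the abelian subalgebras of maximal dimension, such that the sum of the squared
  lengths of the projections of \<open>A\<close> and \<open>B\<close> to \<open>h\<close> is minimal; the choice is over a compact set. If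
  the projection of \<open>A\<close>, say, is not zero, then some root \<open>\<alpha>\<close> does not vanish on it. The root plane
  of \<open>\<alpha>\<close> and the line \<open>\<real>w\<close> in \<open>h\<close> orthogonal to the kernel of \<open>\<alpha>\<close> form a three-dimensional space,
  which contains a vector \<open>n \<noteq> 0\<close> orthogonal to both \<open>A\<close> and \<open>B\<close>. Replacing \<open>\<real>w\<close> by \<open>\<real>n\<close> yields another
  abelian subalgebra of the same dimension with a smaller sum, a contradiction.
\<close>

subsection \<open>The flow of a linear map\<close>

text \<open>The one-parameter group \<open>exp (sT)\<close>. The parameter scales the map itself, so
  that for \<open>T = br X\<close> this is the generator of the adjoint group belonging to
  \<open>s *\<^sub>R X\<close>.\<close>

definition exp_flow :: "('a::euclidean_space \<Rightarrow> 'a) \<Rightarrow> real \<Rightarrow> 'a \<Rightarrow> 'a" where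
  "exp_flow T s = lin_exp (\<lambda>v. s *\<^sub>R T v)"

lemma linear_funpow:
  fixes T :: "'a::real_vector \<Rightarrow> 'a"
  assumes "linear T"
  shows "linear (T ^^ n)"
proof (induction n)
  case (Suc n)
  show ?case using linear_compose[OF Suc assms] by (simp add: o_def)
qed (auto intro: linearI)

lemma funpow_scaleR:
  fixes T :: "'a::real_vector \<Rightarrow> 'a"
  assumes "linear T"
  shows "((\<lambda>v. s *\<^sub>R T v) ^^ n) v = s ^ n *\<^sub>R (T ^^ n) v"
  by (induction n) (simp_all add: linear_scale[OF assms])

lemma exp_flow_summable:
  fixes T :: "'a::euclidean_space \<Rightarrow> 'a"
  assumes "linear T"
  shows "summable (\<lambda>n. (s ^ n / fact n) *\<^sub>R (T ^^ n) v)"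
proof -
  obtain K where K: "K > 0" "\<And>x. norm (T x) \<le> K * norm x"
    using linear_bounded_pos[OF assms] by blast
  have pow: "norm ((T ^^ n) v) \<le> K ^ n * norm v" for n
  proof (induction n)
    case (Suc n)
    have "norm ((T ^^ Suc n) v) \<le> K * norm ((T ^^ n) v)" using K by simp
    also have "\<dots> \<le> K * (K ^ n * norm v)" using Suc K(1) by simp
    finally show ?case by (simp add: mult_ac)
  qed simp
  have "summable (\<lambda>n. inverse (fact n) * (\<bar>s\<bar> * K) ^ n * norm v)"
    by (intro summable_mult2 summable_exp)
  then show ?thesis
  proof (rule summable_comparison_test')
    fix n :: nat
    have "norm ((s ^ n / fact n) *\<^sub>R (T ^^ n) v) = (\<bar>s\<bar> ^ n / fact n) * norm ((T ^^ n) v)"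
      by (simp add: power_abs)
    also have "\<dots> \<le> (\<bar>s\<bar> ^ n / fact n) * (K ^ n * norm v)"
      by (intro mult_left_mono pow) simp
    finally show "norm ((s ^ n / fact n) *\<^sub>R (T ^^ n) v) \<le> inverse (fact n) * (\<bar>s\<bar> * K) ^ n * norm v"
      by (simp add: power_mult_distrib field_simps)
  qed
qed

lemma exp_flow_eq:
  fixes T :: "'a::euclidean_space \<Rightarrow> 'a"
  assumes "linear T"
  shows "exp_flow T s v = (\<Sum>n. (s ^ n / fact n) *\<^sub>R (T ^^ n) v)"
  by (simp add: exp_flow_def lin_exp_def funpow_scaleR[OF assms] divide_inverse mult.commute)

lemma exp_flow_0:
  fixes T :: "'a::euclidean_space \<Rightarrow> 'a"
  assumes "linear T"
  shows "exp_flow T 0 v = v"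
proof -
  have "(\<lambda>n. ((0::real) ^ n / fact n) *\<^sub>R (T ^^ n) v) = (\<lambda>n. if n = 0 then v else 0)"
    by (auto simp: fun_eq_iff)
  then show ?thesis
    using sums_If_finite[of "\<lambda>n. n = 0" "\<lambda>n. v"]
    by (simp add: exp_flow_eq[OF assms] sums_unique[symmetric])
qed

lemma linear_exp_flow:
  fixes T :: "'a::euclidean_space \<Rightarrow> 'a"
  assumes "linear T"
  shows "linear (exp_flow T s)"
proof (rule linearI)
  note L = linear_funpow[OF assms] and S = exp_flow_summable[OF assms]
  show "exp_flow T s (x + y) = exp_flow T s x + exp_flow T s y" for x y
    unfolding exp_flow_eq[OF assms] suminf_add[OF S S]
    by (simp add: linear_add[OF L] scaleR_add_right)
  show "exp_flow T s (c *\<^sub>R x) = c *\<^sub>R exp_flow T s x" for c x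
    unfolding exp_flow_eq[OF assms] suminf_scaleR_right[OF S]
    by (simp add: linear_scale[OF L] mult.commute)
qed

text \<open>Each coordinate of the flow is an everywhere convergent real power series in
  \<open>s\<close>, which can be differentiated term by term.\<close>

lemma exp_flow_inner:
  fixes T :: "'a::euclidean_space \<Rightarrow> 'a"
  assumes "linear T"
  shows "exp_flow T s v \<bullet> b = (\<Sum>n. ((T ^^ n) v \<bullet> b) / fact n * s ^ n)"
    and "summable (\<lambda>n. ((T ^^ n) v \<bullet> b) / fact n * s ^ n)"
  using bounded_linear.suminf[OF bounded_linear_inner_left exp_flow_summable[OF assms], of s v b]
    bounded_linear.summable[OF bounded_linear_inner_left exp_flow_summable[OF assms], of s v b]
  by (simp_all add: exp_flow_eq[OF assms] mult.commute)

lemma exp_flow_commute: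
  fixes T :: "'a::euclidean_space \<Rightarrow> 'a"
  assumes "linear T"
  shows "exp_flow T s (T v) = T (exp_flow T s v)"
proof -
  have "T (exp_flow T s v) = (\<Sum>n. T ((s ^ n / fact n) *\<^sub>R (T ^^ n) v))"
    unfolding exp_flow_eq[OF assms]
    by (rule bounded_linear.suminf[OF _ exp_flow_summable[OF assms]])
      (use assms linear_conv_bounded_linear in blast)
  then show ?thesis
    by (simp add: exp_flow_eq[OF assms] linear_scale[OF assms] funpow_swap1)
qed

lemma exp_flow_has_derivative:
  fixes T :: "'a::euclidean_space \<Rightarrow> 'a"
  assumes "linear T"
  shows "((\<lambda>s. exp_flow T s v) has_vector_derivative exp_flow T s (T v)) (at s within S)"
proof -
  have "((\<lambda>s. exp_flow T s v \<bullet> b) has_real_derivative exp_flow T s (T v) \<bullet> b) (at s)" for b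
  proof -
    let ?c = "\<lambda>n. ((T ^^ n) v \<bullet> b) / fact n"
    have "((\<lambda>s. \<Sum>n. ?c n * s ^ n) has_real_derivative (\<Sum>n. diffs ?c n * s ^ n)) (at s)"
      by (rule termdiffs_strong_converges_everywhere) (rule exp_flow_inner(2)[OF assms])
    \<comment> \<open>Differentiation shifts the coefficients by one, which costs one factor
      \<open>T\<close>, absorbed by replacing \<open>v\<close> with \<open>T v\<close>.\<close>
    moreover have "diffs ?c n = ((T ^^ n) (T v) \<bullet> b) / fact n" for n
      unfolding diffs_def by (simp add: funpow_swap1 field_simps del: of_nat_Suc)
    ultimately show ?thesis
      by (simp add: exp_flow_inner(1)[OF assms])
  qed
  then have "((\<lambda>s. exp_flow T s v \<bullet> b) has_derivative (\<lambda>h. h *\<^sub>R exp_flow T s (T v) \<bullet> b)) (at s within S)" for b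
    unfolding has_real_derivative_iff_has_vector_derivative has_vector_derivative_def
    by (simp add: has_derivative_at_withinI)
  then show ?thesis
    unfolding has_vector_derivative_def
    by (subst has_derivative_componentwise_within) blast
qed

text \<open>The powers of \<open>T\<close> and \<open>T'\<close> are adjoint to each other, hence so
  are the two series term by term.\<close>

lemma exp_flow_adjoint:
  fixes T :: "'a::euclidean_space \<Rightarrow> 'a"
  assumes "linear T" and "linear T'" and adj: "\<And>x y. T x \<bullet> y = x \<bullet> T' y"
  shows "exp_flow T s x \<bullet> y = x \<bullet> exp_flow T' s y"
proof -
  have "(T ^^ n) x \<bullet> y = (T' ^^ n) y \<bullet> x" for n
  proof (induction n arbitrary: x y)
    case (Suc n)
    have "(T ^^ Suc n) x \<bullet> y = (T ^^ n) x \<bullet> T' y" by (simp add: adj)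
    also have "\<dots> = (T' ^^ Suc n) y \<bullet> x" by (simp add: Suc funpow_swap1)
    finally show ?case .
  qed (simp add: inner_commute)
  then have "exp_flow T s x \<bullet> y = exp_flow T' s y \<bullet> x"
    by (simp add: exp_flow_inner(1)[OF assms(1)] exp_flow_inner(1)[OF assms(2)])
  then show ?thesis by (simp add: inner_commute)
qed

text \<open>The curves \<open>exp (sT) x\<close> and \<open>exp (-sT*) y\<close> keep a constant inner product.\<close>

lemma exp_flow_lower_bound:
  fixes T :: "'a::euclidean_space \<Rightarrow> 'a"
  assumes T: "linear T" and M: "\<And>s x. norm (exp_flow T s x) \<le> M * norm x"
  shows "norm x \<le> M * norm (exp_flow T s x)"
proof -
  let ?T' = "adjoint T"
  have T': "linear ?T'" by (rule adjoint_linear[OF T])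
  have adj: "T x \<bullet> y = x \<bullet> ?T' y" for x y by (simp add: adjoint_works[OF T])
  have "((\<lambda>r. exp_flow T r x \<bullet> exp_flow ?T' (- r) x) has_derivative (\<lambda>h. 0)) (at r)" for r
  proof -
    have d1: "((\<lambda>r. exp_flow T r x) has_vector_derivative T (exp_flow T r x)) (at r)"
      using exp_flow_has_derivative[OF T] exp_flow_commute[OF T] by simp
    have "((\<lambda>r. exp_flow ?T' r x) \<circ> uminus has_vector_derivative
            (- 1) *\<^sub>R ?T' (exp_flow ?T' (- r) x)) (at r)"
    proof (rule vector_diff_chain_at)
      show "(uminus has_vector_derivative - 1) (at r)"
        by (auto intro!: derivative_eq_intros)
      show "((\<lambda>r. exp_flow ?T' r x) has_vector_derivative ?T' (exp_flow ?T' (- r) x)) (at (- r))"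
        using exp_flow_has_derivative[OF T'] exp_flow_commute[OF T'] by simp
    qed
    then have d2: "((\<lambda>r. exp_flow ?T' (- r) x) has_vector_derivative
            - ?T' (exp_flow ?T' (- r) x)) (at r)" by (simp add: o_def)
    have "((\<lambda>r. exp_flow T r x \<bullet> exp_flow ?T' (- r) x) has_vector_derivative
       (exp_flow T r x \<bullet> (- ?T' (exp_flow ?T' (- r) x)) + T (exp_flow T r x) \<bullet> exp_flow ?T' (- r) x)) (at r)"
      by (rule bounded_bilinear.has_vector_derivative[OF bounded_bilinear_inner d1 d2])
    then show ?thesis
      by (simp add: adj has_vector_derivative_def)
  qed
  then have "exp_flow T s x \<bullet> exp_flow ?T' (- s) x = exp_flow T 0 x \<bullet> exp_flow ?T' (- 0) x"
    by (intro has_derivative_zero_unique[of UNIV]) auto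
  then have "norm x ^ 2 = exp_flow T s x \<bullet> exp_flow ?T' (- s) x"
    by (simp add: exp_flow_0[OF T] exp_flow_0[OF T'] dot_square_norm)
  \<comment> \<open>Moving the adjoint flow to the other side produces \<open>exp (-sT)\<close>
    acting on \<open>exp (sT) x\<close>, where the upper bound applies at time
    \<open>-s\<close>.\<close>
  also have "\<dots> = exp_flow T (- s) (exp_flow T s x) \<bullet> x"
    by (simp add: exp_flow_adjoint[OF T T' adj])
  also have "\<dots> \<le> norm (exp_flow T (- s) (exp_flow T s x)) * norm x" by (rule norm_cauchy_schwarz)
  also have "\<dots> \<le> M * norm (exp_flow T s x) * norm x" by (intro mult_right_mono M) simp
  finally show ?thesis
    by (cases "x = 0") (simp_all add: power2_eq_square linear_0[OF linear_exp_flow[OF T]])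
qed

subsection \<open>Invariant inner products\<close>

text \<open>A maximal \<open>Q\<close>-orthonormal set \<open>B\<close> is a basis by Gram-Schmidt.
  \<open>L\<close> takes coordinates with respect to \<open>B\<close> and uses them with the
  standard basis, which turns \<open>Q\<close> into the ambient inner product.\<close>

lemma inner_product_isometry:
  fixes Q :: "'a::euclidean_space \<Rightarrow> 'a \<Rightarrow> real"
  assumes bil: "bilinear Q" and sym: "\<And>x y. Q x y = Q y x"
    and pos: "\<And>x. x \<noteq> 0 \<Longrightarrow> Q x x > 0"
  obtains L L' :: "'a \<Rightarrow> 'a" where "linear L" "linear L'" "\<And>x. L (L' x) = x" "\<And>x. L' (L x) = x"
    "\<And>x y. Q x y = L x \<bullet> L y"
proof -
  have lin1: "linear (\<lambda>x. Q x y)" and lin2: "linear (Q x)" for x y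
    using bil by (auto simp: bilinear_def)
  define ortho where "ortho B \<longleftrightarrow> finite B \<and> (\<forall>x\<in>B. \<forall>y\<in>B. Q x y = (if x = y then 1 else 0))" for B
  have coef: "Q (\<Sum>b\<in>B. c b *\<^sub>R b) b = c b" if "ortho B" "b \<in> B" for B c b
  proof -
    have "Q (\<Sum>b\<in>B. c b *\<^sub>R b) b = (\<Sum>a\<in>B. c a * Q a b)"
      by (simp add: linear_sum[OF lin1] linear_scale[OF lin1])
    also have "\<dots> = (\<Sum>a\<in>B. if a = b then c b else 0)"
      using that by (intro sum.cong) (auto simp: ortho_def)
    finally show ?thesis using that by (simp add: ortho_def)
  qed
  have indep: "independent B" if "ortho B" for B
  proof (rule independent_if_scalars_zero)
    show "finite B" using that by (simp add: ortho_def)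
    show "f x = 0" if "(\<Sum>x\<in>B. f x *\<^sub>R x) = 0" "x \<in> B" for f x
      using coef[OF \<open>ortho B\<close> that(2), of f] that(1) linear_0[OF lin1] by simp
  qed
  have "ortho {}" by (simp add: ortho_def)
  moreover have "\<forall>B. ortho B \<longrightarrow> card B < Suc (DIM('a))"
    using independent_bound[OF indep] by (simp add: less_Suc_eq_le)
  ultimately obtain B where B: "ortho B" and max: "\<And>C. ortho C \<Longrightarrow> card C \<le> card B"
    using ex_has_greatest_nat[of ortho "{}" card "Suc DIM('a)"] by blast
  have finB: "finite B" using B by (simp add: ortho_def)
  have expand: "(\<Sum>b\<in>B. Q v b *\<^sub>R b) = v" for v
  proof (rule ccontr)
    assume ne: "(\<Sum>b\<in>B. Q v b *\<^sub>R b) \<noteq> v"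
    \<comment> \<open>The part of \<open>v\<close> that \<open>B\<close> misses is
      \<open>Q\<close>-orthogonal to \<open>B\<close>; normalized, it would enlarge
      \<open>B\<close>.\<close>
    define v' where "v' = v - (\<Sum>b\<in>B. Q v b *\<^sub>R b)"
    have v'0: "Q v' v' > 0" using ne by (intro pos) (simp add: v'_def)
    have v'B: "Q v' b = 0" if "b \<in> B" for b
      using coef[OF B that] by (simp add: v'_def linear_diff[OF lin1])
    define n where "n = v' /\<^sub>R sqrt (Q v' v')"
    have nn: "Q n n = 1"
      using v'0 by (simp add: n_def linear_scale[OF lin1] linear_scale[OF lin2] field_simps)
    have nB: "Q n b = 0" if "b \<in> B" for b
      using v'B[OF that] by (simp add: n_def linear_scale[OF lin1])
    have "n \<notin> B" using nB nn by auto
    then have "ortho (insert n B)"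
      using B nn nB sym by (auto simp: ortho_def)
    from max[OF this] \<open>n \<notin> B\<close> finB show False by simp
  qed
  have "v \<in> span B" for v
    by (subst expand[of v, symmetric]) (intro span_sum span_scale span_base)
  then have "card B = DIM('a)"
    using basis_card_eq_dim[of B UNIV] indep[OF B] by (simp add: subset_iff)
  then obtain \<phi> where \<phi>: "bij_betw \<phi> (Basis :: 'a set) B"
    using finite_same_card_bij[OF finite_Basis finB] by auto
  define L where "L v = (\<Sum>c\<in>Basis. Q v (\<phi> c) *\<^sub>R c)" for v
  define L' where "L' x = (\<Sum>c\<in>Basis. (x \<bullet> c) *\<^sub>R \<phi> c)" for x :: 'a
  have L_inner: "L v \<bullet> c = Q v (\<phi> c)" if "c \<in> Basis" for v c
    using that by (simp add: L_def inner_sum_left inner_Basis if_distrib cong: if_cong)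
  show ?thesis
  proof
    show "linear L" unfolding L_def
      by (intro linearI) (simp_all add: linear_add[OF lin1] linear_scale[OF lin1]
        scaleR_add_left sum.distrib scaleR_sum_right)
    show "linear L'" unfolding L'_def
      by (intro linearI) (simp_all add: inner_add_left scaleR_add_left sum.distrib scaleR_sum_right)
    show LL': "L' (L x) = x" for x
    proof -
      have "L' (L x) = (\<Sum>c\<in>Basis. Q x (\<phi> c) *\<^sub>R \<phi> c)"
        unfolding L'_def by (intro sum.cong) (simp_all add: L_inner)
      also have "\<dots> = (\<Sum>b\<in>B. Q x b *\<^sub>R b)"
        by (rule sum.reindex_bij_betw[OF \<phi>])
      finally show ?thesis using expand by simp
    qed
    show "L (L' x) = x" for x
    proof (rule euclidean_eqI)
      fix c :: 'a assume c: "c \<in> Basis"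
      have "L (L' x) \<bullet> c = (\<Sum>d\<in>Basis. (x \<bullet> d) * Q (\<phi> d) (\<phi> c))"
        using c by (simp add: L_inner L'_def linear_sum[OF lin1] linear_scale[OF lin1])
      also have "\<dots> = (\<Sum>d\<in>Basis. if d = c then x \<bullet> d else 0)"
      proof (intro sum.cong refl)
        fix d :: 'a assume d: "d \<in> Basis"
        have "\<phi> d = \<phi> c \<longleftrightarrow> d = c" "\<phi> c \<in> B" "\<phi> d \<in> B"
          using \<phi> c d by (auto simp: bij_betw_def inj_on_def)
        then show "(x \<bullet> d) * Q (\<phi> d) (\<phi> c) = (if d = c then x \<bullet> d else 0)"
          using B by (simp add: ortho_def)
      qed
      finally show "L (L' x) \<bullet> c = x \<bullet> c" using c by simp
    qed
    show "Q x y = L x \<bullet> L y" for x y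
    proof -
      have "L x \<bullet> L y = (\<Sum>c\<in>Basis. Q y (\<phi> c) * Q x (\<phi> c))"
        unfolding L_def[of y] by (simp add: inner_sum_right L_inner)
      also have "\<dots> = Q x (L' (L y))"
        by (simp add: L'_def L_inner linear_sum[OF lin2] linear_scale[OF lin2])
      finally show ?thesis by (simp add: LL')
    qed
  qed
qed

text \<open>The invariant form is a limit point of the time averages
  \<open>1/N \<integral>\<^sub>0\<^sup>N \<langle>exp (sT) x, exp (sT) y\<rangle> ds\<close>.\<close>

lemma bounded_flow_invariant_form:
  fixes T :: "'a::euclidean_space \<Rightarrow> 'a"
  assumes T: "linear T" and M: "\<And>s x. norm (exp_flow T s x) \<le> M * norm x"
  obtains Q :: "'a \<Rightarrow> 'a \<Rightarrow> real" where "bilinear Q" "\<And>x y. Q x y = Q y x"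
    "\<And>x. x \<noteq> 0 \<Longrightarrow> Q x x > 0" "\<And>x y. Q (T x) y = - Q x (T y)"
proof -
  let ?E = "exp_flow T"
  \<comment> \<open>A bound of at least 1 is positive, so \<open>M' ^ 2\<close> can be divided
    by.\<close>
  define M' where "M' = max M 1"
  have M'1: "M' \<ge> 1" by (simp add: M'_def)
  have M': "norm (?E s x) \<le> M' * norm x" for s x
    by (rule order_trans[OF M]) (simp add: M'_def mult_right_mono)
  have deriv: "((\<lambda>s. ?E s x) has_vector_derivative ?E s (T x)) (at s within A)" for x s A
    by (rule exp_flow_has_derivative[OF T])
  have cont: "continuous_on A (\<lambda>s. ?E s x)" for x A
    by (rule continuous_on_vector_derivative) (rule deriv)
  have int: "(\<lambda>s. ?E s x \<bullet> ?E s y) integrable_on {0..r}" for x y r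
    by (intro integrable_continuous_real continuous_on_inner cont)
  have lin: "linear (?E s)" for s by (rule linear_exp_flow[OF T])
  \<comment> \<open>Lengths of the averaging intervals; the successor keeps the first one
    positive.\<close>
  define R where "R k = real (Suc k)" for k
  have R: "R k > 0" for k by (simp add: R_def)
  define q where "q k x y = integral {0..R k} (\<lambda>s. ?E s x \<bullet> ?E s y) / R k" for k x y
  have q_sym: "q k x y = q k y x" for k x y by (simp add: q_def inner_commute)
  have q_linear: "linear (q k x)" for k x
    by (intro linearI)
       (simp_all add: q_def linear_add[OF lin] linear_scale[OF lin] inner_add_right
         integral_add[OF int int] add_divide_distrib)
  have q_bound: "\<bar>q k x y\<bar> \<le> M' ^ 2 * norm x * norm y" for k x y
  proof -
    have "norm (integral {0..R k} (\<lambda>s. ?E s x \<bullet> ?E s y)) \<le> (M' ^ 2 * norm x * norm y) * (R k - 0)"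
    proof (rule integral_bound)
      fix s
      have "norm (?E s x \<bullet> ?E s y) \<le> norm (?E s x) * norm (?E s y)"
        by (simp add: Cauchy_Schwarz_ineq2)
      also have "\<dots> \<le> (M' * norm x) * (M' * norm y)"
        using M'1 by (intro mult_mono M') auto
      finally show "norm (?E s x \<bullet> ?E s y) \<le> M' ^ 2 * norm x * norm y"
        by (simp add: power2_eq_square mult_ac)
    qed (use R[of k] in \<open>auto intro!: continuous_on_inner cont\<close>)
    then show ?thesis using R[of k] by (simp add: q_def field_simps)
  qed
  \<comment> \<open>This lower bound is uniform in \<open>k\<close>, so definiteness survives the
    passage to the limit.\<close>
  have q_lower: "norm x ^ 2 / M' ^ 2 \<le> q k x x" for k x
  proof -
    have "integral {0..R k} (\<lambda>s. norm x ^ 2 / M' ^ 2) \<le> integral {0..R k} (\<lambda>s. ?E s x \<bullet> ?E s x)"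
    proof (intro integral_le int integrable_const_ivl)
      fix s
      have "norm x \<le> M' * norm (?E s x)" by (rule exp_flow_lower_bound[OF T M'])
      then have "norm x ^ 2 \<le> (M' * norm (?E s x)) ^ 2" by (intro power_mono) auto
      then show "norm x ^ 2 / M' ^ 2 \<le> ?E s x \<bullet> ?E s x"
        using M'1 by (simp add: dot_square_norm power_mult_distrib field_simps)
    qed
    then show ?thesis using R[of k] by (simp add: q_def field_simps)
  qed
  \<comment> \<open>The sum of the two integrands is the derivative of
    \<open>?E s x \<bullet> ?E s y\<close>. Only boundary terms remain; they are bounded while
    \<open>R k\<close> grows, so the limit form makes \<open>T\<close> skew.\<close>
  have q_skew: "q k (T x) y + q k x (T y) = (?E (R k) x \<bullet> ?E (R k) y - x \<bullet> y) / R k" for k x y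
  proof -
    have "((\<lambda>s. ?E s x \<bullet> ?E s (T y) + ?E s (T x) \<bullet> ?E s y) has_integral
        (?E (R k) x \<bullet> ?E (R k) y - ?E 0 x \<bullet> ?E 0 y)) {0..R k}"
      using R[of k]
      by (intro fundamental_theorem_of_calculus
          bounded_bilinear.has_vector_derivative[OF bounded_bilinear_inner] deriv) auto
    then have "integral {0..R k} (\<lambda>s. ?E s x \<bullet> ?E s (T y) + ?E s (T x) \<bullet> ?E s y)
        = ?E (R k) x \<bullet> ?E (R k) y - x \<bullet> y"
      by (simp add: integral_unique exp_flow_0[OF T])
    then show ?thesis
      by (simp add: q_def integral_add[OF int int] add_divide_distrib[symmetric] add.commute)
  qed
  \<comment> \<open>The operator representing \<open>q k\<close>. A bounded sequence of operators
    has a convergent subsequence, which gives convergence of the forms for all \<open>x\<close> and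
    \<open>y\<close> at once.\<close>
  define S where "S k x = (\<Sum>b\<in>Basis. q k x b *\<^sub>R b)" for k x
  have S_inner: "S k x \<bullet> y = q k x y" for k x y
  proof -
    have "q k x y = q k x (\<Sum>b\<in>Basis. (y \<bullet> b) *\<^sub>R b)" by (simp add: euclidean_representation)
    also have "\<dots> = (\<Sum>b\<in>Basis. (y \<bullet> b) * q k x b)"
      by (simp add: linear_sum[OF q_linear] linear_scale[OF q_linear])
    finally show ?thesis by (simp add: S_def inner_sum_left inner_commute[of y] mult.commute)
  qed
  have S_bound: "norm (S k x) \<le> M' ^ 2 * norm x" for k x
  proof -
    have "norm (S k x) ^ 2 = q k x (S k x)" by (simp add: S_inner[symmetric] dot_square_norm)
    also have "\<dots> \<le> M' ^ 2 * norm x * norm (S k x)" using q_bound[of k x "S k x"] by linarith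
    finally show ?thesis
      by (cases "S k x = 0") (simp_all add: power2_eq_square)
  qed
  have q_linear': "linear (\<lambda>x. q k x y)" for k y
  proof -
    have "(\<lambda>x. q k x y) = q k y" by (rule ext) (rule q_sym)
    then show ?thesis using q_linear by simp
  qed
  have S_lin: "linear (S k)" for k
    unfolding S_def
    by (intro linearI) (simp_all add: linear_add[OF q_linear'] linear_scale[OF q_linear']
        scaleR_add_left sum.distrib scaleR_sum_right)
  define BS where "BS k = Blinfun (S k)" for k
  have BS: "blinfun_apply (BS k) = S k" for k
    using S_lin[of k] by (simp add: BS_def bounded_linear_Blinfun_apply linear_conv_bounded_linear)
  have "bounded (range BS)"
    using S_bound M'1 by (auto simp: bounded_iff BS intro!: exI[of _ "M' ^ 2"] norm_blinfun_bound)
  then obtain l r where r: "strict_mono r" and lim: "(BS \<circ> r) \<longlonglongrightarrow> l"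
    using bounded_imp_convergent_subsequence by blast
  define Q where "Q x y = blinfun_apply l x \<bullet> y" for x y
  have Qlim: "(\<lambda>k. q (r k) x y) \<longlonglongrightarrow> Q x y" for x y
  proof -
    have "(\<lambda>k. blinfun_apply ((BS \<circ> r) k) x \<bullet> y) \<longlonglongrightarrow> Q x y"
      unfolding Q_def by (intro tendsto_intros lim)
    then show ?thesis by (simp add: BS S_inner)
  qed
  show ?thesis
  proof
    show "bilinear Q"
      by (auto simp: bilinear_def Q_def blinfun.add_right blinfun.scaleR_right inner_add_left
        inner_add_right intro!: linearI)
    show "Q x y = Q y x" for x y
      using Qlim[of x y] Qlim[of y x] by (simp add: q_sym[of _ x y] LIMSEQ_unique)
    show "Q x x > 0" if "x \<noteq> 0" for x
    proof -
      have "norm x ^ 2 / M' ^ 2 \<le> Q x x"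
        by (rule LIMSEQ_le_const[OF Qlim]) (use q_lower in auto)
      moreover have "norm x ^ 2 / M' ^ 2 > 0" using that M'1 by simp
      ultimately show ?thesis by linarith
    qed
    show "Q (T x) y = - Q x (T y)" for x y
    proof -
      \<comment> \<open>A bound, independent of \<open>k\<close>, for the boundary terms in
        \<open>q_skew\<close>.\<close>
      define C where "C = M' ^ 2 * norm x * norm y + norm x * norm y"
      have "(\<lambda>k. C / R (r k)) \<longlonglongrightarrow> 0"
      proof -
        have "(\<lambda>k. C * inverse (R k)) \<longlonglongrightarrow> C * 0"
          unfolding R_def by (intro tendsto_intros LIMSEQ_inverse_real_of_nat)
        then have "(\<lambda>k. C / R k) \<longlonglongrightarrow> 0" by (simp add: divide_inverse)
        from LIMSEQ_subseq_LIMSEQ[OF this r] show ?thesis by (simp add: o_def)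
      qed
      then have "(\<lambda>k. q (r k) (T x) y + q (r k) x (T y)) \<longlonglongrightarrow> 0"
      proof (rule Lim_null_comparison[rotated], intro always_eventually allI)
        fix k
        have "\<bar>?E (R (r k)) x \<bullet> ?E (R (r k)) y\<bar> \<le> norm (?E (R (r k)) x) * norm (?E (R (r k)) y)"
          by (rule Cauchy_Schwarz_ineq2)
        also have "\<dots> \<le> (M' * norm x) * (M' * norm y)"
          using M'1 by (intro mult_mono M') auto
        finally have "\<bar>?E (R (r k)) x \<bullet> ?E (R (r k)) y - x \<bullet> y\<bar> \<le> C"
          using Cauchy_Schwarz_ineq2[of x y] by (simp add: C_def power2_eq_square mult_ac)
        then show "norm (q (r k) (T x) y + q (r k) x (T y)) \<le> C / R (r k)"
          using R[of "r k"] by (simp add: q_skew divide_right_mono)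
      qed
      moreover have "(\<lambda>k. q (r k) (T x) y + q (r k) x (T y)) \<longlonglongrightarrow> Q (T x) y + Q x (T y)"
        by (intro tendsto_add Qlim)
      ultimately have "Q (T x) y + Q x (T y) = 0" by (rule LIMSEQ_unique[rotated])
      then show ?thesis by simp
    qed
  qed
qed

subsection \<open>The Killing form\<close>

definition lin_trace :: "('a::euclidean_space \<Rightarrow> 'a) \<Rightarrow> real" where
  "lin_trace f = (\<Sum>b\<in>Basis. f b \<bullet> b)"

lemma lin_trace_commute:
  fixes f g :: "'a::euclidean_space \<Rightarrow> 'a"
  assumes "linear f" "linear g"
  shows "lin_trace (\<lambda>x. f (g x)) = lin_trace (\<lambda>x. g (f x))"
proof -
  have expand: "lin_trace (\<lambda>x. f (g x)) = (\<Sum>b\<in>Basis. \<Sum>c\<in>Basis. (g b \<bullet> c) * (f c \<bullet> b))"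
    if f: "linear f" for f g :: "'a \<Rightarrow> 'a"
  proof -
    have "f (g b) = (\<Sum>c\<in>Basis. (g b \<bullet> c) *\<^sub>R f c)" for b
      by (subst euclidean_representation[of "g b", symmetric])
        (simp add: linear_sum[OF f] linear_scale[OF f] del: euclidean_representation)
    then show ?thesis by (simp add: lin_trace_def inner_sum_left)
  qed
  have "lin_trace (\<lambda>x. f (g x)) = (\<Sum>b\<in>Basis. \<Sum>c\<in>Basis. (f c \<bullet> b) * (g b \<bullet> c))"
    by (simp add: expand[OF assms(1)] mult.commute)
  also have "\<dots> = (\<Sum>c\<in>Basis. \<Sum>b\<in>Basis. (f c \<bullet> b) * (g b \<bullet> c))"
    by (rule sum.swap)
  finally show ?thesis by (simp add: expand[OF assms(2)])
qed

text \<open>An invariant form makes \<open>T\<close> conjugate to a map \<open>U\<close> that is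
  skew for the ambient inner product, and the trace of \<open>U\<close> squared is minus the sum of
  the squared lengths of the \<open>U b\<close>.\<close>

lemma lin_trace_square_neg:
  fixes T :: "'a::euclidean_space \<Rightarrow> 'a"
  assumes T: "linear T" and M: "\<And>s x. norm (exp_flow T s x) \<le> M * norm x" and ne: "T v \<noteq> 0"
  shows "lin_trace (\<lambda>x. T (T x)) < 0"
proof -
  obtain Q :: "'a \<Rightarrow> 'a \<Rightarrow> real" where Q: "bilinear Q" "\<And>x y. Q x y = Q y x"
    "\<And>x. x \<noteq> 0 \<Longrightarrow> Q x x > 0" "\<And>x y. Q (T x) y = - Q x (T y)"
    using bounded_flow_invariant_form[OF T M] by blast
  obtain L L' :: "'a \<Rightarrow> 'a" where L: "linear L" "linear L'" "\<And>x. L (L' x) = x" "\<And>x. L' (L x) = x"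
    and QL: "\<And>x y. Q x y = L x \<bullet> L y"
    using inner_product_isometry[OF Q(1-3)] by metis
  define U where "U x = L (T (L' x))" for x
  have U: "linear U"
    using linear_compose[OF linear_compose[OF L(2) T] L(1)] by (simp add: U_def[abs_def] o_def)
  have skew: "U x \<bullet> y = - (x \<bullet> U y)" for x y
    using Q(4)[of "L' x" "L' y"] by (simp add: QL U_def L)
  \<comment> \<open>\<open>T (T x)\<close> is written with \<open>L'\<close> outermost, so that
    cyclicity of the trace can move \<open>L'\<close> inside and complete a second factor
    \<open>U\<close>.\<close>
  have "lin_trace (\<lambda>x. T (T x)) = lin_trace (\<lambda>x. L' ((\<lambda>x. U (L (T x))) x))"
    by (simp add: U_def L)
  also have "\<dots> = lin_trace (\<lambda>x. (\<lambda>x. U (L (T x))) (L' x))"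
    using linear_compose[OF linear_compose[OF T L(1)] U] by (intro lin_trace_commute L) (simp add: o_def)
  also have "\<dots> = lin_trace (\<lambda>x. U (U x))" by (simp add: U_def)
  also have "\<dots> = - (\<Sum>b\<in>Basis. U b \<bullet> U b)"
    by (simp add: lin_trace_def skew sum_negf)
  finally have tr: "lin_trace (\<lambda>x. T (T x)) = - (\<Sum>b\<in>Basis. U b \<bullet> U b)" .
  have "\<exists>b\<in>Basis. U b \<noteq> 0"
  proof (rule ccontr)
    assume "\<not> ?thesis"
    then have "U x = 0" for x
      by (subst euclidean_representation[of x, symmetric])
        (simp add: linear_sum[OF U] linear_scale[OF U] del: euclidean_representation)
    from this[of "L v"] have "L' (L (T v)) = L' 0" by (simp add: U_def L)
    then show False using ne L linear_0[OF L(2)] by simp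
  qed
  then have "(\<Sum>b\<in>Basis. U b \<bullet> U b) > 0"
    by (auto intro!: sum_pos2)
  then show ?thesis using tr by simp
qed

section \<open>Lie algebra identities and the centre\<close>

lemma lie_algebra_clauses:
  assumes "lie_algebra br"
  shows "linear (br x)" "linear (\<lambda>x. br x y)" "br x x = 0" "br x y = - br y x"
    "br x (br y z) = br (br x y) z + br y (br x z)"
proof -
  have bil: "bilinear br" and alt: "\<And>x. br x x = 0"
    and jac: "\<And>x y z. br x (br y z) + br y (br z x) + br z (br x y) = 0"
    using assms by (auto simp: lie_algebra_def)
  show l: "linear (br x)" and r: "linear (\<lambda>x. br x y)" for x y
    using bil by (auto simp: bilinear_def)
  show "br x x = 0" by (rule alt)
  have anti: "br x y = - br y x" for x y
    using alt[of "x + y"] alt[of x] alt[of y]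
    by (simp add: linear_add[OF l] linear_add[OF r] eq_neg_iff_add_eq_0 add.commute)
  then show "br x y = - br y x" .
  have "br y (br z x) = - br y (br x z)"
    by (subst anti[of z x]) (simp add: linear_neg[OF l])
  moreover have "br z (br x y) = - br (br x y) z" by (rule anti)
  ultimately show "br x (br y z) = br (br x y) z + br y (br x z)"
    using jac[of x y z] by (simp add: algebra_simps)
qed

text \<open>The centre is an abelian ideal, hence solvable after a single derivation step.\<close>

lemma semisimple_centre_trivial:
  assumes ss: "semisimple br" and x: "\<And>y. br x y = 0"
  shows "x = 0"
proof -
  have lie: "lie_algebra br" using ss by (simp add: semisimple_def)
  note clauses = lie_algebra_clauses[OF lie]
  define Z where "Z = {x. \<forall>y. br x y = 0}"
  have "br z y = 0" if "y \<in> Z" for z y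
    using that clauses(4)[of z y] by (simp add: Z_def)
  then have "lie_ideal br Z"
    by (auto simp: lie_ideal_def subspace_def Z_def linear_0[OF clauses(2)] linear_0[OF clauses(1)]
      linear_add[OF clauses(2)] linear_scale[OF clauses(2)])
  moreover have "{br x y | x y. x \<in> Z \<and> y \<in> Z} \<subseteq> {0}" by (auto simp: Z_def)
  from span_mono[OF this] have "derived br Z = {0}"
    unfolding derived_def using span_0[of "{br x y | x y. x \<in> Z \<and> y \<in> Z}"] by auto
  then have "solvable br Z"
    unfolding solvable_def by (intro exI[of _ 1]) simp
  ultimately have "Z = {0}" using ss by (auto simp: semisimple_def)
  then show ?thesis using x by (auto simp: Z_def)
qed

text \<open>Every \<open>exp (s ad X)\<close> is a generator of the adjoint group, so the bound on
  this compact set serves all \<open>X\<close> and \<open>s\<close> simultaneously.\<close>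

lemma adjoint_flow_bounded:
  fixes br :: "'a::euclidean_space \<Rightarrow> 'a \<Rightarrow> 'a"
  assumes lie: "lie_algebra br" and "compact (Blinfun ` adjoint_group br)"
  obtains M where "\<And>X s x. norm (exp_flow (br X) s x) \<le> M * norm x"
proof -
  obtain M where M: "\<And>g. g \<in> adjoint_group br \<Longrightarrow> norm (Blinfun g) \<le> M"
    using compact_imp_bounded[OF assms(2)] by (auto simp: bounded_iff)
  note lin = lie_algebra_clauses(1,2)[OF lie]
  have "norm (exp_flow (br X) s x) \<le> M * norm x" for X s x
  proof -
    have "br (s *\<^sub>R X) = (\<lambda>v. s *\<^sub>R br X v)"
      by (rule ext) (rule linear_scale[OF lin(2)])
    then have "exp_flow (br X) s = lin_exp (br (s *\<^sub>R X)) \<circ> id"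
      by (simp add: exp_flow_def)
    also have "\<dots> \<in> adjoint_group br" by (intro ag_mul ag_id)
    finally have G: "exp_flow (br X) s \<in> adjoint_group br" .
    have "bounded_linear (exp_flow (br X) s)"
      using linear_exp_flow[OF lin(1)] by (simp add: linear_conv_bounded_linear)
    then have "norm (exp_flow (br X) s x) \<le> norm (Blinfun (exp_flow (br X) s)) * norm x"
      using norm_blinfun[of "Blinfun (exp_flow (br X) s)" x] by (simp add: bounded_linear_Blinfun_apply)
    also have "\<dots> \<le> M * norm x" by (intro mult_right_mono M G) simp
    finally show ?thesis .
  qed
  then show ?thesis using that by blast
qed

text \<open>The form is minus the Killing form.\<close>

lemma compact_semisimple_invariant_form:
  fixes br :: "'a::euclidean_space \<Rightarrow> 'a \<Rightarrow> 'a"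
  assumes "compact_semisimple br"
  obtains Q :: "'a \<Rightarrow> 'a \<Rightarrow> real" where "bilinear Q" "\<And>x y. Q x y = Q y x"
    "\<And>x. x \<noteq> 0 \<Longrightarrow> Q x x > 0" "\<And>x y z. Q (br x y) z = - Q y (br x z)"
proof -
  have ss: "semisimple br" and lie: "lie_algebra br" and cpt: "compact (Blinfun ` adjoint_group br)"
    using assms by (auto simp: compact_semisimple_def semisimple_def)
  note clauses = lie_algebra_clauses[OF lie]
  define Q where "Q x y = - lin_trace (\<lambda>v. br x (br y v))" for x y
  have sym: "Q x y = Q y x" for x y
    unfolding Q_def using lin_trace_commute[OF clauses(1) clauses(1)] by simp
  have lin: "linear (\<lambda>x. Q x y)" for y
    by (intro linearI) (simp_all add: Q_def lin_trace_def linear_add[OF clauses(2)]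
        linear_scale[OF clauses(2)] inner_add_left sum.distrib sum_distrib_left)
  show ?thesis
  proof
    have "linear (Q x)" for x
    proof -
      have "Q x = (\<lambda>y. Q y x)" by (rule ext) (rule sym)
      from ssubst[OF this, of linear, OF lin] show ?thesis .
    qed
    then show "bilinear Q" using lin by (simp add: bilinear_def)
    show "Q x y = Q y x" for x y by (rule sym)
    show "Q x x > 0" if "x \<noteq> 0" for x
    proof -
      obtain v where "br x v \<noteq> 0" using semisimple_centre_trivial[OF ss] \<open>x \<noteq> 0\<close> by blast
      moreover obtain M where "\<And>X s x. norm (exp_flow (br X) s x) \<le> M * norm x"
        using adjoint_flow_bounded[OF lie cpt] by blast
      ultimately show ?thesis
        using lin_trace_square_neg[OF clauses(1), of x M v] by (simp add: Q_def)
    qed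
    show "Q (br x y) z = - Q y (br x z)" for x y z
    proof -
      have sub: "lin_trace (\<lambda>v. f v - g v) = lin_trace f - lin_trace g" for f g :: "'a \<Rightarrow> 'a"
        by (simp add: lin_trace_def inner_diff_left sum_subtractf)
      have ad: "br (br a b) v = br a (br b v) - br b (br a v)" for a b v
        using clauses(5)[of a b v] by simp
      \<comment> \<open>Once the brackets are expanded as commutators, the two sides of the
        invariance differ exactly by this cyclic permutation.\<close>
      have "lin_trace (\<lambda>v. br x (br y (br z v))) = lin_trace (\<lambda>v. br y (br z (br x v)))"
        using lin_trace_commute[OF clauses(1) linear_compose[OF clauses(1)[of z] clauses(1)[of y]], of x]
        by (simp add: o_def)
      then show ?thesis
        by (simp add: Q_def ad sub linear_diff[OF clauses(1)])
    qed
  qed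
qed

subsection \<open>Root planes\<close>

text \<open>A maximizer of the quadratic form of \<open>S\<close> on the unit sphere of
  \<open>V\<close> is an eigenvector. Invariance of \<open>V\<close> keeps the defect
  \<open>d\<close> in \<open>V\<close>, where it can serve as direction of variation.\<close>

lemma symmetric_eigenvector:
  fixes S :: "'a::euclidean_space \<Rightarrow> 'a"
  assumes S: "linear S" and sym: "\<And>x y. S x \<bullet> y = x \<bullet> S y"
    and V: "subspace V" "V \<noteq> {0}" "\<And>v. v \<in> V \<Longrightarrow> S v \<in> V"
  obtains c v where "v \<in> V" "v \<noteq> 0" "S v = c *\<^sub>R v"
proof -
  let ?K = "V \<inter> sphere 0 1"
  obtain u where u: "u \<in> V" "u \<noteq> 0" using V(1,2) subspace_0 by blast
  have "u /\<^sub>R norm u \<in> ?K" using u V(1) by (simp add: subspace_scale)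
  moreover have "compact ?K" using V(1) by (intro closed_Int_compact closed_subspace compact_sphere)
  moreover have "continuous_on ?K (\<lambda>x. S x \<bullet> x)"
    using S by (intro continuous_intros linear_continuous_on) (simp add: linear_conv_bounded_linear)
  ultimately obtain v where v: "v \<in> ?K" and max: "\<And>y. y \<in> ?K \<Longrightarrow> S y \<bullet> y \<le> S v \<bullet> v"
    using continuous_attains_sup[of ?K "\<lambda>x. S x \<bullet> x"] by blast
  define c where "c = S v \<bullet> v"
  have le: "S y \<bullet> y \<le> c * (y \<bullet> y)" if "y \<in> V" for y
  proof (cases "y = 0")
    case False
    then have "y /\<^sub>R norm y \<in> ?K" using that V(1) by (simp add: subspace_scale)
    from max[OF this] have "S y \<bullet> y / (norm y * norm y) \<le> c"
      using S by (simp add: linear_scale c_def field_simps)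
    then show ?thesis using False by (simp add: field_simps dot_square_norm power2_eq_square)
  qed (simp add: linear_0[OF S])
  define d where "d = S v - c *\<^sub>R v"
  have dV: "d \<in> V" using v V by (simp add: d_def subspace_diff subspace_scale)
  have vv: "v \<bullet> v = 1" using v by (simp add: dot_square_norm)
  \<comment> \<open>Maximality is tested at \<open>v + t *\<^sub>R d\<close>: the gain of first
    order is at most a term quadratic in \<open>t\<close>.\<close>
  have "2 * t * (d \<bullet> d) \<le> t ^ 2 * (c * (d \<bullet> d) - S d \<bullet> d)" for t
  proof -
    have "v + t *\<^sub>R d \<in> V" using v dV V(1) by (simp add: subspace_add subspace_scale)
    from le[OF this]
    have "S v \<bullet> v + 2 * t * (S v \<bullet> d) + t ^ 2 * (S d \<bullet> d)
        \<le> c * (1 + 2 * t * (v \<bullet> d) + t ^ 2 * (d \<bullet> d))"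
      using sym[of d v]
      by (simp add: linear_add[OF S] linear_scale[OF S] inner_add_left inner_add_right vv
          power2_eq_square algebra_simps inner_commute)
    moreover have "S v = d + c *\<^sub>R v" by (simp add: d_def)
    then have "S v \<bullet> d = d \<bullet> d + c * (v \<bullet> d)" by (simp add: inner_add_left)
    ultimately show ?thesis by (simp add: c_def[symmetric] algebra_simps)
  qed
  note ineq = this
  \<comment> \<open>\<open>m\<close> is positive and dominates the quadratic coefficient; with
    \<open>t = (d \<bullet> d) / m\<close> the inequality becomes
    \<open>2 * (d \<bullet> d) \<le> d \<bullet> d\<close>.\<close>
  define m where "m = \<bar>c * (d \<bullet> d) - S d \<bullet> d\<bar> + 1"
  have "d \<bullet> d = 0"
  proof (rule ccontr)
    assume "d \<bullet> d \<noteq> 0"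
    then have pos: "d \<bullet> d > 0" by simp
    define t where "t = (d \<bullet> d) / m"
    have m: "m > 0" by (simp add: m_def)
    have t: "t > 0" using pos m by (simp add: t_def)
    have "t * (2 * (d \<bullet> d)) \<le> t * (t * (c * (d \<bullet> d) - S d \<bullet> d))"
      using ineq[of t] by (simp add: power2_eq_square mult_ac)
    then have "2 * (d \<bullet> d) \<le> t * (c * (d \<bullet> d) - S d \<bullet> d)" using t by simp
    also have "\<dots> \<le> t * m" using t by (intro mult_left_mono) (auto simp: m_def)
    also have "\<dots> = d \<bullet> d" using m by (simp add: t_def)
    finally show False using pos by simp
  qed
  then have "S v = c *\<^sub>R v" by (simp add: d_def)
  moreover have "v \<noteq> 0" using vv by auto
  ultimately show ?thesis using that v by blast
qed

section \<open>Lie algebras whose ambient inner product is invariant\<close>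

locale invariant_lie_algebra =
  fixes br :: "'a::euclidean_space \<Rightarrow> 'a \<Rightarrow> 'a"
  assumes lie: "lie_algebra br"
    and invariant: "br x y \<bullet> z = - (y \<bullet> br x z)"
    and centre: "(\<And>y. br x y = 0) \<Longrightarrow> x = 0"
begin

lemmas linear_right = lie_algebra_clauses(1)[OF lie]
  and linear_left = lie_algebra_clauses(2)[OF lie]
  and alternating = lie_algebra_clauses(3)[OF lie]
  and antisym = lie_algebra_clauses(4)[OF lie]
  and derivation = lie_algebra_clauses(5)[OF lie]

lemmas br_simps =
  linear_0[OF linear_right] linear_0[OF linear_left]
  linear_add[OF linear_right] linear_add[OF linear_left]
  linear_diff[OF linear_right] linear_diff[OF linear_left]
  linear_scale[OF linear_right] linear_scale[OF linear_left]
  linear_neg[OF linear_right] linear_neg[OF linear_left] alternating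

lemma commuting_br: "br H K = 0 \<Longrightarrow> br H (br K v) = br K (br H v)"
  using derivation[of H K v] by (simp add: br_simps)

text \<open>By skewness the squared length of \<open>br X v\<close> is minus the inner product of
  \<open>v\<close> with \<open>br X (br X v)\<close>. Hence kernel and range of \<open>ad X\<close>
  meet only in zero.\<close>

lemma ad_square_zero: "br X (br X v) = 0 \<Longrightarrow> br X v = 0"
  using invariant[of X v "br X v"] by simp

text \<open>These are the Cartan subalgebras. Maximality is phrased through the centralizer, the
  form in which a vector commuting with \<open>h\<close> is recognized as a member.\<close>

definition self_centralizing :: "'a set \<Rightarrow> bool" where
  "self_centralizing h \<longleftrightarrow> subspace h \<and> (\<forall>x\<in>h. \<forall>y\<in>h. br x y = 0) \<and>
     (\<forall>x. (\<forall>y\<in>h. br x y = 0) \<longrightarrow> x \<in> h)"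

text \<open>A vector outside \<open>h\<close> commuting with \<open>h\<close> would span together
  with \<open>h\<close> a larger abelian subalgebra.\<close>

lemma abelian_max_dim_self_centralizing:
  assumes h: "subspace h" "\<And>x y. x \<in> h \<Longrightarrow> y \<in> h \<Longrightarrow> br x y = 0"
    and max: "\<And>k. subspace k \<Longrightarrow> (\<And>x y. x \<in> k \<Longrightarrow> y \<in> k \<Longrightarrow> br x y = 0) \<Longrightarrow> dim k \<le> dim h"
  shows "self_centralizing h"
proof -
  have "z \<in> h" if z: "\<And>y. y \<in> h \<Longrightarrow> br z y = 0" for z
  proof (rule ccontr)
    assume "z \<notin> h"
    have z': "br y z = 0" if "y \<in> h" for y using z[OF that] antisym[of y z] by simp
    have "br x y = 0" if "x \<in> span (insert z h)" "y \<in> span (insert z h)" for x y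
    proof -
      obtain a b where "x - a *\<^sub>R z \<in> h" "y - b *\<^sub>R z \<in> h"
        using \<open>x \<in> _\<close> \<open>y \<in> _\<close> h(1) by (auto simp: span_breakdown_eq span_eq_iff[THEN iffD2])
      then have "br (x - a *\<^sub>R z) (y - b *\<^sub>R z) = 0" "br z (y - b *\<^sub>R z) = 0" "br (x - a *\<^sub>R z) z = 0"
        using h(2) z z' by auto
      then show ?thesis by (simp add: br_simps)
    qed
    from max[OF subspace_span this] have "dim (insert z h) \<le> dim h" by simp
    moreover have "z \<notin> span h" using \<open>z \<notin> h\<close> h(1) by (simp add: span_eq_iff[THEN iffD2])
    ultimately show False by (simp add: dim_insert)
  qed
  then show ?thesis using h by (auto simp: self_centralizing_def)
qed

text \<open>The vectors \<open>w, e, f\<close> span the rank-one subalgebra of a root not vanishing at \<open>H1\<close>: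
  \<open>w\<close> is dual to the root and \<open>e, f\<close> span the real root plane.\<close>

lemma root_triple:
  assumes h: "self_centralizing h" and H1: "H1 \<in> h" "H1 \<noteq> 0"
  obtains w e f where "w \<in> h" "w \<bullet> H1 \<noteq> 0" "e \<noteq> 0" "f \<noteq> 0" "e \<bullet> f = 0"
    "\<And>H. H \<in> h \<Longrightarrow> e \<bullet> H = 0 \<and> f \<bullet> H = 0"
    "\<And>H. H \<in> h \<Longrightarrow> w \<bullet> H = 0 \<Longrightarrow> br H e = 0 \<and> br H f = 0"
proof -
  have comm: "br H K = 0" if "H \<in> h" "K \<in> h" for H K
    using h that by (auto simp: self_centralizing_def)
  \<comment> \<open>Nonzero spaces invariant under \<open>ad h\<close> on which \<open>ad H1\<close>
    is injective. The range of \<open>ad H1\<close> is one of them, and one of least dimension is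
    irreducible and belongs to a root not vanishing at \<open>H1\<close>.\<close>
  define inv_space where "inv_space V \<longleftrightarrow> subspace V \<and> V \<noteq> {0} \<and> (\<forall>H\<in>h. \<forall>v\<in>V. br H v \<in> V) \<and>
      (\<forall>v\<in>V. br H1 v = 0 \<longrightarrow> v = 0)" for V
  have "inv_space (range (br H1))"
    unfolding inv_space_def
  proof (intro conjI ballI impI)
    show "subspace (range (br H1))" by (rule linear_subspace_image[OF linear_right subspace_UNIV])
    show "range (br H1) \<noteq> {0}" using centre[of H1] H1 by auto
    show "br H v \<in> range (br H1)" if "H \<in> h" "v \<in> range (br H1)" for H v
      using that commuting_br[OF comm[OF \<open>H \<in> h\<close> H1(1)]] by auto
    show "v = 0" if "v \<in> range (br H1)" "br H1 v = 0" for v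
      using that ad_square_zero by auto
  qed
  then obtain V where V: "inv_space V" and min: "\<And>W. inv_space W \<Longrightarrow> dim V \<le> dim W"
    using ex_has_least_nat[of inv_space _ dim] by blast
  have subV: "subspace V" and V0: "V \<noteq> {0}" and VH: "\<And>H v. H \<in> h \<Longrightarrow> v \<in> V \<Longrightarrow> br H v \<in> V"
    and VH1: "\<And>v. v \<in> V \<Longrightarrow> br H1 v = 0 \<Longrightarrow> v = 0"
    using V by (auto simp: inv_space_def)
  \<comment> \<open>A symmetric operator commuting with an irreducible action is a scalar.\<close>
  have scalar: "\<exists>m. \<forall>v\<in>V. br H (br H1 v) = m *\<^sub>R v" if H: "H \<in> h" for H
  proof -
    define S where "S v = br H (br H1 v)" for v
    have S: "linear S"
      using linear_compose[OF linear_right linear_right] by (simp add: S_def[abs_def] o_def)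
    have "S x \<bullet> y = x \<bullet> S y" for x y
      using commuting_br[OF comm[OF H H1(1)], of y] by (simp add: S_def invariant)
    moreover have "S v \<in> V" if "v \<in> V" for v using that H H1 VH by (simp add: S_def)
    ultimately obtain c u where u: "u \<in> V" "u \<noteq> 0" "S u = c *\<^sub>R u"
      using symmetric_eigenvector[OF S _ subV V0] by blast
    \<comment> \<open>This eigenspace is again an \<open>inv_space\<close>, because \<open>S\<close>
      commutes with \<open>ad h\<close>; minimality of \<open>V\<close> makes it all of
      \<open>V\<close>.\<close>
    define W where "W = {v \<in> V. S v = c *\<^sub>R v}"
    have W: "subspace W"
      using subV by (auto simp: W_def subspace_def linear_0[OF S] linear_add[OF S] linear_scale[OF S]
          scaleR_add_right)
    have "S (br K v) = br K (S v)" if K: "K \<in> h" for K v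
      using commuting_br[OF comm[OF K H]] commuting_br[OF comm[OF K H1(1)]] by (simp add: S_def)
    then have "inv_space W"
      unfolding inv_space_def using W u VH VH1 by (auto simp: W_def br_simps)
    then have "dim V \<le> dim W" by (rule min)
    then have "W = V" using W subV by (intro subspace_dim_equal) (auto simp: W_def)
    then show ?thesis by (auto simp: W_def S_def)
  qed
  obtain e where e: "e \<in> V" "e \<noteq> 0" using V0 subV subspace_0 by blast
  define f where "f = br H1 e"
  have f: "f \<in> V" "f \<noteq> 0" using e VH H1 VH1 by (auto simp: f_def)
  obtain m1 where m1: "br H1 (br H1 v) = m1 *\<^sub>R v" if "v \<in> V" for v
    using scalar[OF H1(1)] by blast
  have m1_0: "m1 \<noteq> 0"
    using m1[OF e(1)] VH1[of f] f by (auto simp: f_def)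
  have He: "\<exists>a. br H e = a *\<^sub>R f" and Hf: "\<exists>b. br H f = b *\<^sub>R e" if H: "H \<in> h" for H
  proof -
    obtain m where m: "br H (br H1 v) = m *\<^sub>R v" if "v \<in> V" for v using scalar[OF H] by blast
    show "\<exists>b. br H f = b *\<^sub>R e" using m[OF e(1)] by (auto simp: f_def)
    \<comment> \<open>Up to the factor \<open>m1\<close>, \<open>e\<close> is
      \<open>br H1 f\<close>, so the scalar operator \<open>ad H ad H1\<close> also controls
      \<open>br H e\<close>.\<close>
    have "m1 *\<^sub>R br H e = br H (br H1 f)" using m1[OF e(1)] by (simp add: f_def br_simps)
    also have "\<dots> = m *\<^sub>R f" using m[OF f(1)] .
    finally have eq: "m1 *\<^sub>R br H e = m *\<^sub>R f" .
    have "br H e = inverse m1 *\<^sub>R (m1 *\<^sub>R br H e)" using m1_0 by simp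
    also have "\<dots> = (inverse m1 * m) *\<^sub>R f" by (simp only: eq scaleR_scaleR)
    finally show "\<exists>a. br H e = a *\<^sub>R f" by blast
  qed
  have perp: "e \<bullet> H = 0 \<and> f \<bullet> H = 0" if H: "H \<in> h" for H
  proof -
    \<comment> \<open>\<open>e\<close> and \<open>f\<close> both lie in the range of
      \<open>ad H1\<close>, which is orthogonal to everything commuting with
      \<open>H1\<close>.\<close>
    have range: "br H1 v \<bullet> H = 0" for v
      using invariant[of H1 v H] comm[OF H1(1) H] by simp
    have "m1 * (e \<bullet> H) = 0" using range[of f] m1[OF e(1)] by (simp add: f_def)
    then show ?thesis using m1_0 range[of e] by (simp add: f_def)
  qed
  have ef: "e \<bullet> f = 0" using invariant[of H1 e e] by (simp add: f_def inner_commute)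
  \<comment> \<open>In \<open>br H (br e f)\<close> the derivation rule leaves only multiples of
    \<open>br f f\<close> and \<open>br e e\<close>; so \<open>w\<close> commutes with
    \<open>h\<close> and belongs to it.\<close>
  define w where "w = br e f"
  have "br w H = 0" if H: "H \<in> h" for H
  proof -
    obtain a b where "br H e = a *\<^sub>R f" "br H f = b *\<^sub>R e" using He[OF H] Hf[OF H] by blast
    then have "br H w = 0" using derivation[of H e f] by (simp add: w_def br_simps)
    then show ?thesis using antisym[of w H] by simp
  qed
  then have w: "w \<in> h" using h by (simp add: self_centralizing_def)
  \<comment> \<open>Thus \<open>w \<bullet> H\<close> is a fixed positive multiple of the
    coefficient of \<open>f\<close> in \<open>br H e\<close>, the value of the root at
    \<open>H\<close>.\<close>
  have wH: "w \<bullet> H = f \<bullet> br H e" for H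
    using invariant[of e f H] antisym[of e H] by (simp add: w_def)
  show ?thesis
  proof
    show "w \<bullet> H1 \<noteq> 0" using f by (simp add: wH f_def)
    show "br H e = 0 \<and> br H f = 0" if H: "H \<in> h" "w \<bullet> H = 0" for H
    proof -
      obtain a b where ab: "br H e = a *\<^sub>R f" "br H f = b *\<^sub>R e" using He[OF H(1)] Hf[OF H(1)] by blast
      have "a = 0" using H(2) ab(1) f(2) by (simp add: wH)
      moreover have "b * (e \<bullet> e) = 0"
        using invariant[of H f e] ab \<open>a = 0\<close> by simp
      ultimately show ?thesis using ab e(2) by simp
    qed
  qed (use w e f ef perp in auto)
qed

end

subsection \<open>Cartan subalgebras orthogonal to a pair\<close>

text \<open>The centralizer contains \<open>X\<close>, so any abelian subalgebra containing the
  centralizer commutes with \<open>X\<close> and lies inside it.\<close>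

lemma regularI:
  assumes lie: "lie_algebra br" and comm: "\<And>Y Z. br X Y = 0 \<Longrightarrow> br X Z = 0 \<Longrightarrow> br Y Z = 0"
  shows "regular br X"
proof -
  note clauses = lie_algebra_clauses[OF lie]
  have "subspace (centralizer br X)"
    by (simp add: centralizer_def subspace_def linear_0[OF clauses(1)] linear_add[OF clauses(1)]
        linear_scale[OF clauses(1)])
  then have "abelian_subalgebra br (centralizer br X)"
    using comm by (simp add: abelian_subalgebra_def lie_subalgebra_def centralizer_def linear_0[OF clauses(1)])
  moreover have "k \<subseteq> centralizer br X" if "abelian_subalgebra br k" "centralizer br X \<subseteq> k" for k
  proof -
    have "X \<in> k" using that(2) clauses(3) by (auto simp: centralizer_def)
    then show ?thesis using that(1) by (auto simp: abelian_subalgebra_def centralizer_def)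
  qed
  ultimately show ?thesis by (auto simp: regular_def cartan_subalgebra_def)
qed

text \<open>The inner products with \<open>A\<close> and \<open>B\<close> map a three-dimensional
  space to the plane, so two points collide; \<open>n\<close> is their difference.\<close>

lemma exists_orthogonal_to_pair:
  fixes u v w A B :: "'a::euclidean_space"
  assumes ne: "u \<noteq> 0" "v \<noteq> 0" "w \<noteq> 0" and perp: "u \<bullet> v = 0" "u \<bullet> w = 0" "v \<bullet> w = 0"
  obtains n where "n \<in> span {u, v, w}" "n \<noteq> 0" "n \<bullet> A = 0" "n \<bullet> B = 0"
proof -
  define \<phi> where "\<phi> x = (x \<bullet> A, x \<bullet> B)" for x
  have lin: "linear \<phi>" by (intro linearI) (simp_all add: \<phi>_def inner_add_left)
  have "u \<noteq> v" "u \<noteq> w" "v \<noteq> w" using ne perp by auto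
  then have card: "card {u, v, w} = 3" by simp
  have "independent {u, v, w}"
    using ne perp by (intro pairwise_orthogonal_independent)
      (auto simp: pairwise_def orthogonal_def inner_commute)
  then have dim: "dim {u, v, w} = 3" using card by (simp add: dim_eq_card_independent)
  have "\<not> inj_on \<phi> (span {u, v, w})"
  proof
    assume "inj_on \<phi> (span {u, v, w})"
    from dim_image_eq[OF lin this] have "dim (\<phi> ` {u, v, w}) = 3" using dim by simp
    moreover have "dim (\<phi> ` {u, v, w}) \<le> DIM(real \<times> real)" by (rule dim_subset_UNIV)
    ultimately show False by simp
  qed
  then obtain x y where "x \<in> span {u, v, w}" "y \<in> span {u, v, w}" "x \<noteq> y" "\<phi> x = \<phi> y"
    by (auto simp: inj_on_def)
  then show ?thesis
    by (intro that[of "x - y"]) (simp_all add: span_diff \<phi>_def inner_diff_left)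
qed

context invariant_lie_algebra
begin

text \<open>The reflection \<open>R\<close> replaces the line \<open>\<real>w\<close> of \<open>h\<close> by a line of the rank-one subalgebra
  orthogonal to \<open>A\<close> and \<open>B\<close>, and fixes the kernel of the root in \<open>h\<close>.\<close>

lemma root_reflection:
  assumes h: "self_centralizing h" and H: "H \<in> h" "H \<bullet> C \<noteq> 0" and C: "C = A \<or> C = B"
  obtains R w where "linear R" "\<And>x y. R x \<bullet> R y = x \<bullet> y"
    "\<And>x y. x \<in> h \<Longrightarrow> y \<in> h \<Longrightarrow> br (R x) (R y) = 0"
    "w \<in> h" "w \<bullet> w = 1" "w \<bullet> C \<noteq> 0"
    "\<And>x. x \<in> h \<Longrightarrow> R x \<bullet> A = x \<bullet> A - (x \<bullet> w) * (w \<bullet> A)"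
    "\<And>x. x \<in> h \<Longrightarrow> R x \<bullet> B = x \<bullet> B - (x \<bullet> w) * (w \<bullet> B)"
proof -
  have sub: "subspace h" and comm: "\<And>x y. x \<in> h \<Longrightarrow> y \<in> h \<Longrightarrow> br x y = 0"
    using h by (auto simp: self_centralizing_def)
  \<comment> \<open>\<open>H1\<close> is the projection of \<open>C\<close> to \<open>h\<close>,
    nonzero because \<open>C\<close> is not orthogonal to \<open>h\<close>.\<close>
  obtain H1 z where H1: "H1 \<in> h" and z: "\<And>x. x \<in> h \<Longrightarrow> x \<bullet> z = 0" and Ceq: "C = H1 + z"
    using orthogonal_subspace_decomp_exists[of h C] span_eq_iff[THEN iffD2, OF sub]
    by (metis orthogonal_def inner_commute)
  have "H1 \<noteq> 0" using H z[OF H(1)] by (auto simp: Ceq)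
  then obtain w0 e f where w0: "w0 \<in> h" "w0 \<bullet> H1 \<noteq> 0" and ef: "e \<noteq> 0" "f \<noteq> 0" "e \<bullet> f = 0"
    and perp: "\<And>H. H \<in> h \<Longrightarrow> e \<bullet> H = 0 \<and> f \<bullet> H = 0"
    and kernel: "\<And>H. H \<in> h \<Longrightarrow> w0 \<bullet> H = 0 \<Longrightarrow> br H e = 0 \<and> br H f = 0"
    using root_triple[OF h H1] by blast
  have w0_ne: "w0 \<noteq> 0" using w0(2) by auto
  have "w0 \<bullet> e = 0" "w0 \<bullet> f = 0" using perp[OF w0(1)] by (auto simp: inner_commute)
  then obtain n0 where n0: "n0 \<in> span {w0, e, f}" "n0 \<noteq> 0" "n0 \<bullet> A = 0" "n0 \<bullet> B = 0"
    using exists_orthogonal_to_pair[of w0 e f A B] w0_ne ef by blast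
  define w n where "w = w0 /\<^sub>R norm w0" and "n = n0 /\<^sub>R norm n0"
  have w: "w \<in> h" using w0 sub by (simp add: w_def subspace_scale)
  have ww: "w \<bullet> w = 1" using w0_ne by (simp add: w_def dot_square_norm power2_eq_square)
  have nn: "n \<bullet> n = 1" using n0 by (simp add: n_def dot_square_norm power2_eq_square)
  have nA: "n \<bullet> A = 0" "n \<bullet> B = 0" using n0 by (simp_all add: n_def)
  have "w0 \<bullet> C \<noteq> 0" using w0 z[OF w0(1)] by (simp add: Ceq inner_add_right)
  then have wC: "w \<bullet> C \<noteq> 0" using w0_ne by (simp add: w_def)
  \<comment> \<open>The kernel of the root in \<open>h\<close> commutes with, and is orthogonal to,
    the line of \<open>n\<close>.\<close>
  have u: "br u n = 0" "u \<bullet> n = 0" if "u \<in> h" "u \<bullet> w = 0" for u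
  proof -
    have uw0: "w0 \<bullet> u = 0" using that(2) w0_ne by (simp add: w_def inner_commute)
    have "subspace {v. br u v = 0 \<and> u \<bullet> v = 0}"
      by (simp add: subspace_def br_simps inner_add_right)
    moreover have "{w0, e, f} \<subseteq> {v. br u v = 0 \<and> u \<bullet> v = 0}"
      using comm[OF that(1) w0(1)] kernel[OF that(1) uw0] perp[OF that(1)] uw0
      by (auto simp: inner_commute)
    ultimately have "span {w0, e, f} \<subseteq> {v. br u v = 0 \<and> u \<bullet> v = 0}" by (rule span_minimal[rotated])
    then have "br u n0 = 0 \<and> u \<bullet> n0 = 0" using n0(1) by blast
    then show "br u n = 0" "u \<bullet> n = 0" by (simp_all add: n_def br_simps)
  qed
  \<comment> \<open>Householder reflection exchanging the unit vectors \<open>w\<close> and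
    \<open>n\<close>. They differ because \<open>n\<close> is orthogonal to \<open>C\<close> and
    \<open>w\<close> is not.\<close>
  define d where "d = w - n"
  define R where "R x = x - (2 * (x \<bullet> d) / (d \<bullet> d)) *\<^sub>R d" for x
  have "d \<noteq> 0" using wC C nA by (auto simp: d_def)
  then have dd: "d \<bullet> d \<noteq> 0" by simp
  have lin: "linear R"
    by (intro linearI) (simp_all add: R_def inner_add_left add_divide_distrib algebra_simps)
  have iso: "R x \<bullet> R y = x \<bullet> y" for x y
  proof -
    define a b where "a = 2 * (x \<bullet> d) / (d \<bullet> d)" and "b = 2 * (y \<bullet> d) / (d \<bullet> d)"
    have "R x \<bullet> R y = x \<bullet> y - b * (x \<bullet> d) - a * (y \<bullet> d) + a * (b * (d \<bullet> d))"
      by (simp add: R_def a_def[symmetric] b_def[symmetric] inner_diff_left inner_diff_right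
          inner_commute[of d y] right_diff_distrib)
    moreover have "b * (d \<bullet> d) = 2 * (y \<bullet> d)" using dd by (simp add: b_def)
    moreover have "a * (y \<bullet> d) = b * (x \<bullet> d)" by (simp add: a_def b_def)
    ultimately show ?thesis by simp
  qed
  have dd_eq: "d \<bullet> d = 2 * (w \<bullet> d)"
    using ww nn by (simp add: d_def inner_diff_left inner_diff_right inner_commute)
  have Rw: "R w = n"
  proof -
    have "2 * (w \<bullet> d) / (d \<bullet> d) = 1" unfolding dd_eq[symmetric] using dd by simp
    then have "R w = w - 1 *\<^sub>R d" by (simp only: R_def)
    then show ?thesis by (simp add: d_def)
  qed
  \<comment> \<open>Projection of \<open>h\<close> to the kernel of the root, where \<open>R\<close>
    is the identity. As \<open>n\<close> is orthogonal to \<open>A\<close> and \<open>B\<close>,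
    replacing \<open>w\<close> by \<open>n\<close> removes exactly the contribution of
    \<open>w\<close> to the inner products.\<close>
  define p where "p x = x - (x \<bullet> w) *\<^sub>R w" for x
  have p: "p x \<in> h" "p x \<bullet> w = 0" if "x \<in> h" for x
    using that w sub ww by (simp_all add: p_def subspace_diff subspace_scale inner_diff_left)
  have Rx: "R x = p x + (x \<bullet> w) *\<^sub>R n" if "x \<in> h" for x
  proof -
    have "R (p x) = p x" using p[OF that] u by (simp add: R_def d_def inner_diff_right)
    moreover have "R x = R (p x) + (x \<bullet> w) *\<^sub>R R w"
      by (simp add: p_def linear_diff[OF lin] linear_scale[OF lin])
    ultimately show ?thesis by (simp add: Rw)
  qed
  show ?thesis
  proof (rule that[OF lin iso _ w ww wC])
    show "br (R x) (R y) = 0" if "x \<in> h" "y \<in> h" for x y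
    proof -
      have "br (p x) n = 0" "br (p y) n = 0" "br (p x) (p y) = 0"
        using p that u comm by simp_all
      moreover have "br n (p y) = - br (p y) n" by (rule antisym)
      ultimately show ?thesis by (simp add: Rx that br_simps)
    qed
  qed (simp_all add: Rx nA inner_add_left, simp_all add: p_def inner_diff_left)
qed

text \<open>The competing subalgebras are parametrized as images of one fixed \<open>h0\<close>
  under linear isometries. These form a compact set of operators, and their images keep the maximal
  dimension.\<close>

lemma orthogonal_self_centralizing:
  obtains h where "self_centralizing h" "\<And>x. x \<in> h \<Longrightarrow> x \<bullet> A = 0 \<and> x \<bullet> B = 0"
proof -
  define abel where "abel k \<longleftrightarrow> subspace k \<and> (\<forall>x\<in>k. \<forall>y\<in>k. br x y = 0)" for k
  have "abel {0}" by (simp add: abel_def br_simps)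
  moreover have "\<forall>k. abel k \<longrightarrow> dim k < Suc DIM('a)"
    using dim_subset_UNIV by (auto simp: less_Suc_eq_le)
  ultimately obtain h0 where h0: "abel h0" and max: "\<And>k. abel k \<Longrightarrow> dim k \<le> dim h0"
    using ex_has_greatest_nat[of abel "{0}" dim "Suc DIM('a)"] by blast
  have sub0: "subspace h0" using h0 by (simp add: abel_def)
  obtain U where U: "U \<subseteq> h0" "pairwise orthogonal U" "\<And>x. x \<in> U \<Longrightarrow> norm x = 1"
    and indU: "independent U" and spanU: "span U = h0"
    using orthonormal_basis_subspace[OF sub0] by metis
  have finU: "finite U" using independent_bound[OF indU] by simp
  define K where "K = {L :: 'a \<Rightarrow>\<^sub>L 'a. (\<forall>x y. blinfun_apply L x \<bullet> blinfun_apply L y = x \<bullet> y) \<and>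
      (\<forall>x y. x \<in> h0 \<longrightarrow> y \<in> h0 \<longrightarrow> br (blinfun_apply L x) (blinfun_apply L y) = 0)}"
  \<comment> \<open>\<open>L\<close> carries the orthonormal basis \<open>U\<close> of
    \<open>h0\<close> to one of its image, so \<open>F L\<close> sums the squared lengths of the
    projections of \<open>A\<close> and \<open>B\<close> to that image.\<close>
  define F where "F L = (\<Sum>u\<in>U. (blinfun_apply L u \<bullet> A)\<^sup>2) + (\<Sum>u\<in>U. (blinfun_apply L u \<bullet> B)\<^sup>2)"
    for L :: "'a \<Rightarrow>\<^sub>L 'a"
  have cont: "continuous_on S (\<lambda>L :: 'a \<Rightarrow>\<^sub>L 'a. blinfun_apply L x)" for S x
    by (intro bounded_bilinear.continuous_on[OF bounded_bilinear_blinfun_apply] continuous_intros)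
  have bbl: "bounded_bilinear br"
    using lie by (simp add: lie_algebra_def bilinear_conv_bounded_bilinear)
  have "compact K"
    unfolding compact_eq_bounded_closed
  proof
    have "norm L \<le> 1" if "L \<in> K" for L
    proof (rule norm_blinfun_bound)
      show "norm (blinfun_apply L x) \<le> 1 * norm x" for x
        using that by (simp add: K_def norm_eq_sqrt_inner)
    qed simp
    then show "bounded K" by (auto simp: bounded_iff)
    show "closed K"
      unfolding K_def
      by (intro closed_Collect_conj closed_Collect_all closed_Collect_imp closed_Collect_eq
          open_Collect_const continuous_on_inner bounded_bilinear.continuous_on[OF bbl] cont continuous_on_const)
  qed
  moreover have "id_blinfun \<in> K" using h0 by (simp add: K_def abel_def)
  moreover have "continuous_on K F" unfolding F_def by (intro continuous_intros cont)
  ultimately obtain L where L: "L \<in> K" and min: "\<And>L'. L' \<in> K \<Longrightarrow> F L \<le> F L'"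
    using continuous_attains_inf[of K F] by blast
  have iso: "blinfun_apply L x \<bullet> blinfun_apply L y = x \<bullet> y" for x y using L by (simp add: K_def)
  have linL: "linear (blinfun_apply L)" by (simp add: blinfun.bounded_linear_right bounded_linear.linear)
  define h where "h = blinfun_apply L ` h0"
  have "inj (blinfun_apply L)"
  proof (rule injI)
    fix x y assume "blinfun_apply L x = blinfun_apply L y"
    then show "x = y"
      using iso[of "x - y" "x - y"] by (simp add: linear_diff[OF linL])
  qed
  then have dimh: "dim h = dim h0"
    unfolding h_def by (intro dim_image_eq[OF linL]) (auto intro: inj_on_subset)
  have h: "self_centralizing h"
  proof (rule abelian_max_dim_self_centralizing)
    show "subspace h" unfolding h_def by (rule linear_subspace_image[OF linL sub0])
    show "br x y = 0" if "x \<in> h" "y \<in> h" for x y using that L by (auto simp: h_def K_def)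
    show "dim k \<le> dim h" if "subspace k" "\<And>x y. x \<in> k \<Longrightarrow> y \<in> k \<Longrightarrow> br x y = 0" for k
      using max[of k] that dimh by (simp add: abel_def)
  qed
  have "H \<bullet> C = 0" if H: "H \<in> h" and C: "C = A \<or> C = B" for H C
  proof (rule ccontr)
    assume "H \<bullet> C \<noteq> 0"
    then obtain R w where R: "linear R" "\<And>x y. R x \<bullet> R y = x \<bullet> y"
        "\<And>x y. x \<in> h \<Longrightarrow> y \<in> h \<Longrightarrow> br (R x) (R y) = 0"
      and w: "w \<in> h" "w \<bullet> w = 1" "w \<bullet> C \<noteq> 0"
      and RA: "\<And>x. x \<in> h \<Longrightarrow> R x \<bullet> A = x \<bullet> A - (x \<bullet> w) * (w \<bullet> A)"
        "\<And>x. x \<in> h \<Longrightarrow> R x \<bullet> B = x \<bullet> B - (x \<bullet> w) * (w \<bullet> B)"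
      using root_reflection[OF h H _ C] by metis
    \<comment> \<open>The reflected subalgebra is again the image of \<open>h0\<close> under an
      isometry, hence a competitor.\<close>
    define L' where "L' = Blinfun R o\<^sub>L L"
    have L'x: "blinfun_apply L' x = R (blinfun_apply L x)" for x
      using R(1) by (simp add: L'_def bounded_linear_Blinfun_apply linear_conv_bounded_linear)
    have "L' \<in> K" using R iso by (auto simp: K_def L'x h_def)
    obtain w' where w': "w' \<in> h0" "w = blinfun_apply L w'" using w(1) by (auto simp: h_def)
    have parseval: "(\<Sum>u\<in>U. (blinfun_apply L u \<bullet> w) * (blinfun_apply L u \<bullet> y)) = w \<bullet> y" for y
    proof -
      have "(\<Sum>u\<in>U. (w' \<bullet> u) *\<^sub>R u) = w'"
        using w'(1) spanU by (intro orthonormal_basis_expand U finU) auto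
      then have "w = blinfun_apply L (\<Sum>u\<in>U. (w' \<bullet> u) *\<^sub>R u)" using w'(2) by simp
      also have "\<dots> = (\<Sum>u\<in>U. (blinfun_apply L u \<bullet> w) *\<^sub>R blinfun_apply L u)"
        by (simp add: linear_sum[OF linL] linear_scale[OF linL] w'(2) iso inner_commute)
      finally have "w \<bullet> y = (\<Sum>u\<in>U. (blinfun_apply L u \<bullet> w) *\<^sub>R blinfun_apply L u) \<bullet> y" by simp
      then show ?thesis by (simp add: inner_sum_left)
    qed
    \<comment> \<open>Removing the component along the unit vector \<open>w\<close> lowers the
      squared length of the projection of \<open>y\<close> by
      \<open>(w \<bullet> y)\<^sup>2\<close>; for \<open>y = C\<close> this is a strict
      loss.\<close>
    have drop: "(\<Sum>u\<in>U. (blinfun_apply L u \<bullet> y - (blinfun_apply L u \<bullet> w) * (w \<bullet> y))\<^sup>2)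
        = (\<Sum>u\<in>U. (blinfun_apply L u \<bullet> y)\<^sup>2) - (w \<bullet> y)\<^sup>2" for y
    proof -
      have "(\<Sum>u\<in>U. (blinfun_apply L u \<bullet> y - (blinfun_apply L u \<bullet> w) * (w \<bullet> y))\<^sup>2)
        = (\<Sum>u\<in>U. (blinfun_apply L u \<bullet> y)\<^sup>2
            - 2 * (w \<bullet> y) * ((blinfun_apply L u \<bullet> w) * (blinfun_apply L u \<bullet> y))
            + (w \<bullet> y)\<^sup>2 * ((blinfun_apply L u \<bullet> w) * (blinfun_apply L u \<bullet> w)))"
        by (intro sum.cong refl) (simp add: power2_eq_square algebra_simps)
      also have "\<dots> = (\<Sum>u\<in>U. (blinfun_apply L u \<bullet> y)\<^sup>2) - 2 * (w \<bullet> y) * (w \<bullet> y) + (w \<bullet> y)\<^sup>2 * (w \<bullet> w)"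
        by (simp add: sum.distrib sum_subtractf parseval flip: sum_distrib_left)
      finally show ?thesis using w(2) by (simp add: power2_eq_square)
    qed
    have "blinfun_apply L u \<in> h" if "u \<in> U" for u using that U(1) by (auto simp: h_def)
    then have "F L' = F L - ((w \<bullet> A)\<^sup>2 + (w \<bullet> B)\<^sup>2)"
      by (simp add: F_def L'x RA drop cong: sum.cong)
    moreover have "(w \<bullet> A)\<^sup>2 + (w \<bullet> B)\<^sup>2 > 0"
      using C w(3) by (auto simp: add_pos_nonneg add_nonneg_pos)
    ultimately show False using min[OF \<open>L' \<in> K\<close>] by simp
  qed
  then show ?thesis using that[OF h] by blast
qed

section \<open>Regular elements and the range of \<open>ad X\<close>\<close>

text \<open>An element of \<open>h\<close> with centralizer of least dimension works: if some
  \<open>Y\<close> outside \<open>h\<close> commuted with it, a small shift towards an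
  \<open>H\<close> in \<open>h\<close> not commuting with \<open>Y\<close> would shrink the
  centralizer.\<close>

lemma self_centralizing_has_regular:
  assumes h: "self_centralizing h"
  obtains X where "X \<in> h" "\<And>Y. br X Y = 0 \<longleftrightarrow> Y \<in> h"
proof -
  have sub: "subspace h" and comm: "\<And>x y. x \<in> h \<Longrightarrow> y \<in> h \<Longrightarrow> br x y = 0"
    using h by (auto simp: self_centralizing_def)
  define Z where "Z X = {Y. br X Y = 0}" for X
  have subZ: "subspace (Z X)" for X by (simp add: Z_def subspace_def br_simps)
  obtain X where X: "X \<in> h" and min: "\<And>Y. Y \<in> h \<Longrightarrow> dim (Z X) \<le> dim (Z Y)"
    using ex_has_least_nat[of "\<lambda>X. X \<in> h" 0 "\<lambda>X. dim (Z X)"] sub subspace_0 by blast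
  have "Y \<in> h" if Y: "br X Y = 0" for Y
  proof (rule ccontr)
    assume "Y \<notin> h"
    then obtain H where H: "H \<in> h" "br Y H \<noteq> 0" using h unfolding self_centralizing_def by blast
    have HY: "br H Y \<noteq> 0" using H(2) antisym[of Y H] by auto
    have subR: "subspace (range (br X))" by (rule linear_subspace_image[OF linear_right subspace_UNIV])
    \<comment> \<open>Being injective on its own range, \<open>ad X\<close> is bounded below there
      by some \<open>\<epsilon>\<close>.\<close>
    have "\<forall>z\<in>range (br X). br X z = 0 \<longrightarrow> z = 0" using ad_square_zero by auto
    then obtain \<epsilon> where \<epsilon>: "\<epsilon> > 0" "\<And>z. z \<in> range (br X) \<Longrightarrow> \<epsilon> * norm z \<le> norm (br X z)"
      using injective_imp_isometric[OF closed_subspace[OF subR] subR, of "br X"] linear_right[of X]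
      by (auto simp: linear_conv_bounded_linear)
    obtain M where M: "M > 0" "\<And>z. norm (br H z) \<le> M * norm z"
      using linear_bounded_pos[OF linear_right] by blast
    \<comment> \<open>Small enough that \<open>t\<close> times \<open>ad H\<close> has at most half
      the strength of this lower bound.\<close>
    define t where "t = \<epsilon> / (2 * M)"
    have t: "t > 0" using \<epsilon>(1) M(1) by (simp add: t_def)
    define X' where "X' = X + t *\<^sub>R H"
    have X': "X' \<in> h" using X H sub by (simp add: X'_def subspace_add subspace_scale)
    \<comment> \<open>If \<open>X'\<close> kills \<open>v\<close>, it also kills
      \<open>br X v\<close>, because \<open>X\<close> and \<open>X'\<close> commute. On this vector
      \<open>ad X\<close> is cancelled by the weaker perturbation, so the vector is zero.\<close>
    have "Z X' \<subseteq> Z X"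
    proof
      fix v assume "v \<in> Z X'"
      then have "br X' (br X v) = 0"
        using commuting_br[OF comm[OF X' X]] by (simp add: Z_def br_simps)
      then have "br X (br X v) = - (t *\<^sub>R br H (br X v))"
        by (simp add: X'_def br_simps eq_neg_iff_add_eq_0)
      then have "norm (br X (br X v)) = t * norm (br H (br X v))" using t by simp
      also have "\<dots> \<le> t * (M * norm (br X v))" using t M by (intro mult_left_mono) auto
      also have "\<dots> = \<epsilon> / 2 * norm (br X v)" using M(1) by (simp add: t_def)
      finally have "\<epsilon> * norm (br X v) \<le> \<epsilon> / 2 * norm (br X v)"
        using \<epsilon>(2)[of "br X v"] by simp
      then have "br X v = 0" using \<epsilon>(1) by simp
      then show "v \<in> Z X" by (simp add: Z_def)
    qed
    moreover have "Y \<in> Z X" "Y \<notin> Z X'" using Y HY t by (simp_all add: Z_def X'_def br_simps)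
    ultimately have "Z X' \<noteq> Z X" by blast
    then show False
      using subspace_dim_equal[OF subZ subZ \<open>Z X' \<subseteq> Z X\<close> min[OF X']] by blast
  qed
  then show ?thesis using that[OF X] comm[OF X] by blast
qed

text \<open>For the skew map \<open>ad X\<close>, the component of \<open>C\<close> orthogonal to
  the range lies in the kernel; by assumption it is then orthogonal to \<open>C\<close>, hence to
  itself.\<close>

lemma orthogonal_kernel_imp_range:
  assumes "\<And>Y. br X Y = 0 \<Longrightarrow> Y \<bullet> C = 0"
  shows "C \<in> range (br X)"
proof -
  have "span (range (br X)) = range (br X)"
    by (simp add: span_eq_iff linear_subspace_image[OF linear_right subspace_UNIV])
  then obtain y z where y: "y \<in> range (br X)" and z: "\<And>v. z \<bullet> br X v = 0" and C: "C = y + z"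
    using orthogonal_subspace_decomp_exists[of "range (br X)" C] by (metis orthogonal_def rangeI)
  have "br X z = 0" using invariant[of X z "br X z"] z by simp
  then have "z \<bullet> C = 0" by (rule assms)
  moreover have "z \<bullet> y = 0" using y z by auto
  ultimately have "z = 0" by (simp add: C inner_add_right)
  then show ?thesis using y C by simp
qed

lemma pair_in_regular_range:
  obtains X where "\<And>Y Z. br X Y = 0 \<Longrightarrow> br X Z = 0 \<Longrightarrow> br Y Z = 0"
    "A \<in> range (br X)" "B \<in> range (br X)"
proof -
  obtain h where h: "self_centralizing h" and perp: "\<And>x. x \<in> h \<Longrightarrow> x \<bullet> A = 0 \<and> x \<bullet> B = 0"
    using orthogonal_self_centralizing by blast
  obtain X where X: "X \<in> h" "\<And>Y. br X Y = 0 \<longleftrightarrow> Y \<in> h"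
    using self_centralizing_has_regular[OF h] by blast
  show ?thesis
  proof
    show "br Y Z = 0" if "br X Y = 0" "br X Z = 0" for Y Z
      using that h by (simp add: X(2) self_centralizing_def)
  qed (auto intro!: orthogonal_kernel_imp_range simp: X(2) perp)
qed

end

theorem theorem1:
  fixes br :: "'a::euclidean_space \<Rightarrow> 'a \<Rightarrow> 'a" and A B :: 'a
  assumes "compact_semisimple br"
  shows "\<exists>X. regular br X \<and> A \<in> range (br X) \<and> B \<in> range (br X)"
proof -
  have ss: "semisimple br" and lie: "lie_algebra br"
    using assms by (auto simp: compact_semisimple_def semisimple_def)
  note clauses = lie_algebra_clauses[OF lie]
  obtain Q :: "'a \<Rightarrow> 'a \<Rightarrow> real" where Q: "bilinear Q" "\<And>x y. Q x y = Q y x"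
    "\<And>x. x \<noteq> 0 \<Longrightarrow> Q x x > 0" "\<And>x y z. Q (br x y) z = - Q y (br x z)"
    using compact_semisimple_invariant_form[OF assms] by blast
  obtain L L' :: "'a \<Rightarrow> 'a" where L: "linear L" "linear L'" "\<And>x. L (L' x) = x" "\<And>x. L' (L x) = x"
    and QL: "\<And>x y. Q x y = L x \<bullet> L y"
    using inner_product_isometry[OF Q(1-3)] by metis
  \<comment> \<open>The bracket transported by the isometry \<open>L\<close>, for which the
    invariant form becomes the ambient inner product. An \<open>X\<close> found for
    \<open>br'\<close> is carried back as \<open>L' X\<close>.\<close>
  define br' where "br' x y = L (br (L' x) (L' y))" for x y
  have L0: "L x = 0 \<longleftrightarrow> x = 0" for x using L linear_0 by metis
  interpret conj: invariant_lie_algebra br'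
  proof
    have "bilinear br'"
      unfolding bilinear_def br'_def
      by (auto intro!: linearI simp: linear_add[OF L(1)] linear_scale[OF L(1)] linear_add[OF L(2)]
          linear_scale[OF L(2)] linear_add[OF clauses(1)] linear_add[OF clauses(2)]
          linear_scale[OF clauses(1)] linear_scale[OF clauses(2)])
    moreover have "br' x (br' y z) + br' y (br' z x) + br' z (br' x y) = 0" for x y z
      using lie by (simp add: br'_def L lie_algebra_def L0 flip: linear_add[OF L(1)])
    ultimately show "lie_algebra br'"
      by (simp add: lie_algebra_def br'_def clauses(3) L0)
    show "br' x y \<bullet> z = - (y \<bullet> br' x z)" for x y z
      using Q(4)[of "L' x" "L' y" "L' z"] by (simp add: QL L br'_def)
    show "x = 0" if "\<And>y. br' x y = 0" for x
    proof -
      have "br (L' x) y = 0" for y using that[of "L y"] by (simp add: br'_def L L0)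
      then have "L' x = 0" by (rule semisimple_centre_trivial[OF ss])
      then show ?thesis using L(3)[of x] linear_0[OF L(1)] by simp
    qed
  qed
  obtain X where X: "\<And>Y Z. br' X Y = 0 \<Longrightarrow> br' X Z = 0 \<Longrightarrow> br' Y Z = 0"
    "L A \<in> range (br' X)" "L B \<in> range (br' X)"
    using conj.pair_in_regular_range by blast
  have range: "C \<in> range (br (L' X))" if "L C \<in> range (br' X)" for C
  proof -
    obtain v where "L C = br' X v" using \<open>L C \<in> range (br' X)\<close> by blast
    then have "L' (L C) = L' (L (br (L' X) (L' v)))" by (simp add: br'_def)
    then show ?thesis by (simp add: L)
  qed
  have "br Y Z = 0" if "br (L' X) Y = 0" "br (L' X) Z = 0" for Y Z
    using X(1)[of "L Y" "L Z"] that by (simp add: br'_def L L0)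
  from regularI[OF lie this] show ?thesis using range X(2,3) by blast
qed

end
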